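(* Let $n\ge1$. There are no cominuscule parabolic sets of roots of $\mathfrak{osp}(1|2n)$.
   Context: $\mathfrak{g}=\mathfrak{osp}(1|2n)$, $\mathfrak{g}_{\bar0}\cong\mathfrak{sp}(2n)$, with standard Cartan subalgebra and root system $\Delta=\{\pm\delta_k\pm\delta_l,\ \pm2\delta_k\mid 1\le k\ne l\le n\}\sqcup\{\pm\delta_k\mid1\le k\le n\}$ (even roots, odd roots). A proper subset $P\subsetneq\Delta$ is parabolic if $\Delta=P\cup(-P)$ and ($\alpha,\beta\in P$, $\alpha+\beta\in\Delta$ imply $\alpha+\beta\in P$). Its nilradical is $N^+=P\setminus(-P)$, and $P$ is cominuscule if the subalgebra $\mathfrak{n}^+=\bigoplus_{\alpha\in N^+}\mathfrak{g}^\alpha$ is abelian. *)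

theory Defs
  imports "HOL-Analysis.Analysis"
begin

text \<open>
  The natural number \<open>n \<ge> 1\<close> is the cardinality of a finite type \<open>'n\<close>.
  The defining representation of the Lie superalgebra \<open>osp(1|2n)\<close> over the complex numbers
  is the superspace of dimension \<open>(1|2n)\<close> with standard basis indexed by \<open>unit + 'n + 'n\<close>;
  the index \<open>Inl ()\<close> spans the even part, and the indices \<open>Inr (Inl k)\<close>, \<open>Inr (Inr k)\<close>
  form a symplectic basis of the odd part.
\<close>

type_synonym 'n idx = "unit + 'n + 'n"
type_synonym 'n svec = "complex ^ ('n idx)"
type_synonym 'n smat = "complex ^ ('n idx) ^ ('n idx)"

fun parity :: "'n idx \<Rightarrow> nat" where
  "parity (Inl u) = 0"
| "parity (Inr i) = 1"

definition homogeneous :: "nat \<Rightarrow> ('n::finite) svec \<Rightarrow> bool" where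
  "homogeneous q v \<longleftrightarrow> (\<forall>i. v $ i \<noteq> 0 \<longrightarrow> parity i = q)"

text \<open>The homogeneous component of degree \<open>p\<close> of a matrix in \<open>gl(1|2n)\<close>.\<close>

definition component :: "nat \<Rightarrow> ('n::finite) smat \<Rightarrow> 'n smat" where
  "component p X = (\<chi> i j. if (parity i + parity j) mod 2 = p then X $ i $ j else 0)"

text \<open>
  \<open>[X, Y] = X Y - (-1)\<^bsup>p q\<^esup> Y X\<close> for \<open>X\<close>, \<open>Y\<close> homogeneous of degrees \<open>p\<close>, \<open>q\<close>,
  extended bilinearly.
\<close>

definition superbracket :: "('n::finite) smat \<Rightarrow> 'n smat \<Rightarrow> 'n smat" where
  "superbracket X Y = (\<Sum>p\<in>{0, 1}. \<Sum>q\<in>{0, 1}.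
     component p X ** component q Y - (- 1) ^ (p * q) *\<^sub>R (component q Y ** component p X))"

text \<open>The even supersymmetric form: symmetric on the even part, symplectic on the odd part.\<close>

fun gram :: "'n idx \<Rightarrow> 'n idx \<Rightarrow> complex" where
  "gram (Inl _) (Inl _) = 1"
| "gram (Inr (Inl k)) (Inr (Inr l)) = (if k = l then 1 else 0)"
| "gram (Inr (Inr k)) (Inr (Inl l)) = (if k = l then - 1 else 0)"
| "gram _ _ = 0"

definition form :: "('n::finite) svec \<Rightarrow> 'n svec \<Rightarrow> complex" where
  "form v w = (\<Sum>i\<in>UNIV. \<Sum>j\<in>UNIV. v $ i * gram i j * w $ j)"

definition osp :: "('n::finite) smat set" where
  "osp = {X. \<forall>p\<in>{0, 1}. \<forall>q\<in>{0, 1}. \<forall>v w. homogeneous q v \<longrightarrow>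
     form (component p X *v v) w + (- 1) ^ (p * q) * form v (component p X *v w) = 0}"

text \<open>The standard Cartan subalgebra; its elements are the matrices \<open>diag(0, a, -a)\<close>.\<close>

definition cartan :: "('n::finite) smat set" where
  "cartan = {H \<in> osp. \<forall>i j. i \<noteq> j \<longrightarrow> H $ i $ j = 0}"

text \<open>
  The dual of the Cartan subalgebra is identified with \<open>complex ^ 'n\<close> via the basis
  \<open>\<delta>\<^sub>1, \<dots>, \<delta>\<^sub>n\<close>, where \<open>\<delta>\<^sub>k\<close> sends \<open>diag(0, a, -a)\<close> to \<open>a\<^sub>k\<close>.
\<close>

definition delta :: "'n \<Rightarrow> complex ^ ('n::finite)" where
  "delta k = axis k 1"

definition weight_eval :: "complex ^ 'n \<Rightarrow> ('n::finite) smat \<Rightarrow> complex" where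
  "weight_eval \<alpha> H = (\<Sum>k\<in>UNIV. \<alpha> $ k * H $ Inr (Inl k) $ Inr (Inl k))"

definition root_space :: "complex ^ 'n \<Rightarrow> ('n::finite) smat set" where
  "root_space \<alpha> = {X \<in> osp. \<forall>H\<in>cartan. superbracket H X = mat (weight_eval \<alpha> H) ** X}"

definition even_roots :: "(complex ^ ('n::finite)) set" where
  "even_roots =
     {s *s delta k + t *s delta l | s t k l. s \<in> {1, - 1} \<and> t \<in> {1, - 1} \<and> k \<noteq> l} \<union>
     {s *s (2 *s delta k) | s k. s \<in> {1, - 1}}"

definition odd_roots :: "(complex ^ ('n::finite)) set" where
  "odd_roots = {s *s delta k | s k. s \<in> {1, - 1}}"

definition roots :: "(complex ^ ('n::finite)) set" where
  "roots = even_roots \<union> odd_roots"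

definition parabolic :: "(complex ^ ('n::finite)) set \<Rightarrow> bool" where
  "parabolic P \<longleftrightarrow> P \<subset> roots \<and> roots = P \<union> uminus ` P \<and>
     (\<forall>\<alpha>\<in>P. \<forall>\<beta>\<in>P. \<alpha> + \<beta> \<in> roots \<longrightarrow> \<alpha> + \<beta> \<in> P)"

definition nilradical_roots :: "(complex ^ ('n::finite)) set \<Rightarrow> (complex ^ 'n) set" where
  "nilradical_roots P = P - uminus ` P"

text \<open>
  The sum of the root spaces \<open>g\<^sup>\<alpha>\<close> for \<open>\<alpha>\<close> in \<open>nilradical_roots P\<close>, a finite set when
  \<open>P\<close> is a set of roots.
\<close>

definition nilradical :: "(complex ^ ('n::finite)) set \<Rightarrow> 'n smat set" where
  "nilradical P = {\<Sum>\<alpha>\<in>nilradical_roots P. x \<alpha> | x. \<forall>\<alpha>\<in>nilradical_roots P. x \<alpha> \<in> root_space \<alpha>}"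

definition cominuscule :: "(complex ^ ('n::finite)) set \<Rightarrow> bool" where
  "cominuscule P \<longleftrightarrow> parabolic P \<and>
     (\<forall>X\<in>nilradical P. \<forall>Y\<in>nilradical P. superbracket X Y = 0)"

end

theory Submission imports Defs begin

text \<open>
  Unlike for a Lie algebra, a single odd root vector can obstruct commutativity: for odd \<open>X\<close> one
  has \<open>[X, X] = 2 X\<^sup>2\<close>, and in \<open>osp(1|2n)\<close> the vector \<open>X\<close> of root \<open>\<plusminus>\<delta>\<^sub>k\<close> squares to a nonzero vector
  of root \<open>\<plusminus>2\<delta>\<^sub>k\<close> (lemma \<open>superbracket_odd_root_vector\<close>). So it suffices that the nilradical of
  every parabolic set contains an odd root (lemma \<open>parabolic_odd_root\<close>). Otherwise \<open>P\<close> contains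
  all \<open>\<plusminus>\<delta>\<^sub>k\<close>; every even root is a sum of two of these, so closedness of \<open>P\<close> would give all of
  \<open>\<Delta>\<close>, and \<open>P\<close> would not be proper.
\<close>

section \<open>The form and the Cartan subalgebra in coordinates\<close>

lemma sum_idx:
  fixes f :: "('n::finite) idx \<Rightarrow> 'a::comm_monoid_add"
  shows "(\<Sum>i\<in>UNIV. f i)
    = f (Inl ()) + ((\<Sum>k\<in>UNIV. f (Inr (Inl k))) + (\<Sum>k\<in>UNIV. f (Inr (Inr k))))"
  by (simp add: UNIV_Plus_UNIV[symmetric] sum.Plus UNIV_unit del: UNIV_Plus_UNIV)

lemma form_coordinates:
  fixes v w :: "('n::finite) svec"
  shows "form v w = v $ Inl () * w $ Inl ()
    + (\<Sum>k\<in>UNIV. v $ Inr (Inl k) * w $ Inr (Inr k) - v $ Inr (Inr k) * w $ Inr (Inl k))"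
proof -
  have delta1: "(\<Sum>l\<in>UNIV. a * (if k = l then 1 else 0) * g l) = a * g k"
    for k :: 'n and a :: complex and g
    by (subst sum.cong[OF refl, where h = "\<lambda>l. if k = l then a * g l else 0"]) auto
  have delta2: "(\<Sum>l\<in>UNIV. a * (if k = l then - 1 else 0) * g l) = - (a * g k)"
    for k :: 'n and a :: complex and g
    by (subst sum.cong[OF refl, where h = "\<lambda>l. if k = l then - (a * g l) else 0"]) auto
  show ?thesis
    by (simp add: form_def sum_idx delta1 delta2 sum_subtractf sum_negf)
qed

lemma cartan_component:
  fixes H :: "('n::finite) smat"
  assumes "H \<in> cartan"
  shows "component 0 H = H" and "component 1 H = 0"
proof -
  have diag: "H $ i $ j = 0" if "i \<noteq> j" for i j
    using assms that by (simp add: cartan_def)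
  have even: "i \<noteq> j" if "(parity i + parity j) mod 2 = Suc 0" for i j :: "'n idx"
    using that by (auto simp flip: mult_2)
  show "component 0 H = H" and "component 1 H = 0"
    by (auto simp: component_def vec_eq_iff diag even simp flip: mult_2)
qed

lemma cartan_mult_vec:
  assumes "H \<in> cartan"
  shows "(H *v v) $ i = H $ i $ i * v $ i"
proof -
  have "(H *v v) $ i = (\<Sum>j\<in>UNIV. if i = j then H $ i $ i * v $ i else 0)"
    unfolding matrix_vector_mult_def vec_lambda_beta
    by (rule sum.cong) (use assms in \<open>auto simp: cartan_def\<close>)
  then show ?thesis by simp
qed

text \<open>
  Both equations are invariance of the form, tested on the pairs of basis vectors on which the
  form does not vanish.
\<close>

lemma cartan_diagonal:
  fixes H :: "('n::finite) smat"
  assumes H: "H \<in> cartan"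
  shows "H $ Inl () $ Inl () = 0"
    and "H $ Inr (Inr k) $ Inr (Inr k) = - H $ Inr (Inl k) $ Inr (Inl k)"
proof -
  have inv: "form (H *v v) w + form v (H *v w) = 0" if "q \<in> {0, 1}" "homogeneous q v" for q v w
    using H that cartan_component(1)[OF H] unfolding cartan_def osp_def by force
  have "homogeneous 0 (axis (Inl ()) 1 :: 'n svec)"
    by (simp add: homogeneous_def axis_def)
  from inv[OF _ this, of "axis (Inl ()) 1"]
  show "H $ Inl () $ Inl () = 0"
    by (simp add: form_coordinates cartan_mult_vec[OF H] axis_def)
  have "homogeneous 1 (axis (Inr (Inl k)) 1 :: 'n svec)"
    by (simp add: homogeneous_def axis_def)
  from inv[OF _ this, of "axis (Inr (Inr k)) 1"]
  have "H $ Inr (Inl k) $ Inr (Inl k) + H $ Inr (Inr k) $ Inr (Inr k) = 0"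
    by (simp add: form_coordinates cartan_mult_vec[OF H] axis_def if_distrib if_distribR
        sum.If_cases cong: if_cong)
  then show "H $ Inr (Inr k) $ Inr (Inr k) = - H $ Inr (Inl k) $ Inr (Inl k)"
    by (simp add: add_eq_0_iff)
qed

section \<open>Odd root vectors\<close>

text \<open>The index of the basis vector of weight \<open>\<delta>\<^sub>k\<close> (for \<open>True\<close>) or \<open>-\<delta>\<^sub>k\<close> (for \<open>False\<close>).\<close>

definition weight_index :: "bool \<Rightarrow> 'n \<Rightarrow> 'n idx" where
  "weight_index b k = Inr (if b then Inl k else Inr k)"

definition sgn_of :: "bool \<Rightarrow> complex" where
  "sgn_of b = (if b then 1 else - 1)"

text \<open>
  With \<open>e\<^sub>\<plusminus>\<close> the basis vectors of weight \<open>\<plusminus>\<delta>\<^sub>k\<close>, the root vector of \<open>s\<delta>\<^sub>k\<close> has to send \<open>e\<^bsub>-s\<^esub>\<close> to a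
  multiple of \<open>e\<^sub>0\<close> and \<open>e\<^sub>0\<close> to a multiple of \<open>e\<^bsub>s\<^esub>\<close>. Invariance of the form fixes the ratio of
  the two coefficients to be \<open>-s\<close>.
\<close>

definition odd_root_vector :: "bool \<Rightarrow> 'n \<Rightarrow> ('n::finite) smat" where
  "odd_root_vector b k = (\<chi> i j.
     if i = Inl () \<and> j = weight_index (\<not> b) k then 1
     else if i = weight_index b k \<and> j = Inl () then - sgn_of b else 0)"

lemma component_odd_root_vector:
  "component 0 (odd_root_vector b k) = 0"
  "component 1 (odd_root_vector b k) = odd_root_vector b k"
  by (auto simp: component_def odd_root_vector_def weight_index_def vec_eq_iff)

lemma odd_root_vector_mult_vec:
  fixes v :: "('n::finite) svec"
  shows "(odd_root_vector b k *v v) $ i =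
    (if i = Inl () then v $ weight_index (\<not> b) k
     else if i = weight_index b k then - sgn_of b * v $ Inl () else 0)"
proof -
  have "(odd_root_vector b k *v v) $ i =
    (\<Sum>j\<in>UNIV. (if j = weight_index (\<not> b) k then if i = Inl () then v $ j else 0 else 0)
      + (if j = Inl () then if i = weight_index b k then - sgn_of b * v $ j else 0 else 0))"
    unfolding matrix_vector_mult_def odd_root_vector_def
    by (auto simp: weight_index_def intro!: sum.cong)
  also have "\<dots> = (if i = Inl () then v $ weight_index (\<not> b) k
     else if i = weight_index b k then - sgn_of b * v $ Inl () else 0)"
    unfolding sum.distrib by (auto simp: weight_index_def)
  finally show ?thesis .
qed

text \<open>
  Writing \<open>v\<^sub>0\<close> and \<open>v\<^sub>-\<close> for the coordinates of \<open>v\<close> along \<open>e\<^sub>0\<close> and \<open>e\<^bsub>-s\<^esub>\<close>, the two terms of the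
  invariance condition are \<open>v\<^sub>- w\<^sub>0 - v\<^sub>0 w\<^sub>-\<close> and \<open>v\<^sub>0 w\<^sub>- + v\<^sub>- w\<^sub>0\<close>. For even \<open>v\<close> one has \<open>v\<^sub>- = 0\<close> and
  their sum vanishes; for odd \<open>v\<close> one has \<open>v\<^sub>0 = 0\<close> and their difference vanishes.
\<close>

lemma odd_root_vector_osp:
  fixes k :: "'n::finite"
  shows "odd_root_vector b k \<in> osp"
proof -
  let ?X = "odd_root_vector b k"
  have delta: "(\<Sum>l\<in>UNIV. (if l = k then g l else 0) * h l) = g k * h k"
    "(\<Sum>l\<in>UNIV. h l * (if l = k then g l else 0)) = h k * g k" for g h :: "'n \<Rightarrow> complex"
    by (simp_all add: if_distrib if_distribR sum.If_cases cong: if_cong)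
  have left: "form (?X *v v) w
      = v $ weight_index (\<not> b) k * w $ Inl () - v $ Inl () * w $ weight_index (\<not> b) k" for v w
    by (cases b) (simp_all add: form_coordinates odd_root_vector_mult_vec weight_index_def
        sgn_of_def sum_subtractf sum_negf delta)
  have right: "form v (?X *v w)
      = v $ Inl () * w $ weight_index (\<not> b) k + v $ weight_index (\<not> b) k * w $ Inl ()" for v w
    by (cases b) (simp_all add: form_coordinates odd_root_vector_mult_vec weight_index_def
        sgn_of_def sum_subtractf sum_negf delta)
  have even: "v $ weight_index (\<not> b) k = 0" if "homogeneous 0 v" for v :: "'n svec"
    using that by (force simp: homogeneous_def weight_index_def)
  have odd: "v $ Inl () = 0" if "homogeneous (Suc 0) v" for v :: "'n svec"
    using that by (force simp: homogeneous_def)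
  have zero: "form 0 w = 0" "form v 0 = 0" for v w :: "'n svec"
    by (simp_all add: form_coordinates)
  show ?thesis
    unfolding osp_def
    using component_odd_root_vector(2)[of b k]
    by (auto simp: component_odd_root_vector(1) left right zero dest!: even odd)
qed

lemma odd_root_vector_root_space:
  fixes k :: "'n::finite"
  shows "odd_root_vector b k \<in> root_space (sgn_of b *s delta k)"
proof -
  let ?X = "odd_root_vector b k"
  have "superbracket H ?X = mat (weight_eval (sgn_of b *s delta k) H) ** ?X"
    if H: "H \<in> cartan" for H :: "'n smat"
  proof -
    have weight: "weight_eval (sgn_of b *s delta k) H
        = sgn_of b * H $ Inr (Inl k) $ Inr (Inl k)"
      by (simp add: weight_eval_def delta_def axis_def if_distrib if_distribR sum.If_cases
          cong: if_cong)
    have HX: "(H ** ?X) $ i $ j = H $ i $ i * ?X $ i $ j" for i j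
    proof -
      have "(H ** ?X) $ i $ j = (\<Sum>l\<in>UNIV. if i = l then H $ i $ i * ?X $ i $ j else 0)"
        unfolding matrix_matrix_mult_def vec_lambda_beta
        by (rule sum.cong) (use H in \<open>auto simp: cartan_def\<close>)
      then show ?thesis by simp
    qed
    have XH: "(?X ** H) $ i $ j = ?X $ i $ j * H $ j $ j" for i j
    proof -
      have "(?X ** H) $ i $ j = (\<Sum>l\<in>UNIV. if j = l then ?X $ i $ j * H $ j $ j else 0)"
        unfolding matrix_matrix_mult_def vec_lambda_beta
        by (rule sum.cong) (use H in \<open>auto simp: cartan_def\<close>)
      then show ?thesis by simp
    qed
    have scalar: "(mat c ** ?X) $ i $ j = c * ?X $ i $ j" for c i j
      by (simp add: matrix_matrix_mult_def mat_def if_distrib if_distribR sum.If_cases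
          cong: if_cong)
    have "superbracket H ?X = H ** ?X - ?X ** H"
      using cartan_component[OF H] component_odd_root_vector[of b k]
      by (simp add: superbracket_def)
    moreover have "(H $ i $ i - H $ j $ j) * ?X $ i $ j
        = weight_eval (sgn_of b *s delta k) H * ?X $ i $ j" for i j
      unfolding weight
      by (simp add: odd_root_vector_def weight_index_def sgn_of_def cartan_diagonal[OF H])
    ultimately show ?thesis
      by (simp add: vec_eq_iff HX XH scalar algebra_simps)
  qed
  then show ?thesis
    using odd_root_vector_osp by (simp add: root_space_def)
qed

text \<open>
  The bracket is \<open>2 X\<^sup>2\<close>, and \<open>X\<^sup>2\<close> sends \<open>e\<^bsub>-s\<^esub>\<close> to \<open>e\<^sub>0\<close> and on to a nonzero multiple of \<open>e\<^bsub>s\<^esub>\<close>.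
\<close>

lemma superbracket_odd_root_vector:
  fixes k :: "'n::finite"
  shows "superbracket (odd_root_vector b k) (odd_root_vector b k) \<noteq> 0"
proof -
  let ?X = "odd_root_vector b k"
  let ?e = "axis (weight_index (\<not> b) k) 1 :: 'n svec"
  have square: "superbracket ?X ?X = ?X ** ?X + ?X ** ?X"
    using component_odd_root_vector[of b k] by (simp add: superbracket_def)
  have "(superbracket ?X ?X *v ?e) $ weight_index b k = - 2 * sgn_of b"
    unfolding square matrix_vector_mult_add_rdistrib matrix_vector_mul_assoc[symmetric]
      vector_add_component odd_root_vector_mult_vec
    by (simp add: axis_def weight_index_def)
  then show ?thesis
    by (auto simp: sgn_of_def split: if_splits)
qed

section \<open>Nilradicals of parabolic sets\<close>

lemma parabolic_odd_root:
  fixes P :: "(complex ^ ('n::finite)) set"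
  assumes P: "parabolic P"
  obtains b k where "sgn_of b *s delta k \<in> nilradical_roots P"
proof -
  have proper: "P \<subset> roots" and total: "roots = P \<union> uminus ` P"
    and closed: "\<And>\<alpha> \<beta>. \<alpha> \<in> P \<Longrightarrow> \<beta> \<in> P \<Longrightarrow> \<alpha> + \<beta> \<in> roots \<Longrightarrow> \<alpha> + \<beta> \<in> P"
    using P by (auto simp: parabolic_def)
  have odd_root: "s *s delta k \<in> roots" if "s \<in> {1, - 1}" for s and k :: 'n
    using that by (auto simp: roots_def odd_roots_def)
  have "\<exists>s k. s \<in> {1, - 1} \<and> s *s delta k \<notin> P"
  proof (rule ccontr)
    assume "\<not> ?thesis"
    then have all: "s *s delta k \<in> P" if "s \<in> {1, - 1}" for s k
      using that by blast
    have "\<alpha> \<in> P" if \<alpha>: "\<alpha> \<in> roots" for \<alpha>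
    proof -
      consider "\<alpha> \<in> odd_roots"
        | s k t l where "s \<in> {1, - 1}" "t \<in> {1, - 1}" "\<alpha> = s *s delta k + t *s delta l"
        | s k where "s \<in> {1, - 1}" "\<alpha> = s *s (2 *s delta k)"
        using \<alpha> unfolding roots_def even_roots_def by blast
      then show ?thesis
      proof cases
        case 1
        then show ?thesis using all by (auto simp: odd_roots_def)
      next
        case 2
        then show ?thesis using closed[OF all all] \<alpha> by blast
      next
        case 3
        then have "\<alpha> = s *s delta k + s *s delta k"
          by (simp add: vec_eq_iff)
        then show ?thesis using closed[OF all all] 3 \<alpha> by blast
      qed
    qed
    then show False using proper by blast
  qed
  then obtain s and k :: 'n where s: "s \<in> {1, - 1}" and notin: "s *s delta k \<notin> P" by blast
  have "s *s delta k \<in> uminus ` P"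
    using odd_root[OF s, of k] notin total by blast
  then have "- (s *s delta k) \<in> P" by force
  moreover have "- (s *s delta k) \<notin> uminus ` P" using notin by force
  moreover have "- (s *s delta k) = sgn_of (s = - 1) *s delta k"
    using s by (auto simp: sgn_of_def vec_eq_iff)
  ultimately show thesis
    using that[of "s = - 1" k] by (simp add: nilradical_roots_def)
qed

lemma finite_roots: "finite (roots :: (complex ^ ('n::finite)) set)"
proof -
  have "roots \<subseteq> (\<lambda>(s, t, k, l). s *s delta k + t *s delta l) ` ({1, - 1} \<times> {1, - 1} \<times> UNIV \<times> UNIV)
    \<union> (\<lambda>(s, k). s *s (2 *s delta k)) ` ({1, - 1} \<times> UNIV)
    \<union> (\<lambda>(s, k). s *s (delta k :: complex ^ 'n)) ` ({1, - 1} \<times> UNIV)"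
    (is "_ \<subseteq> ?S")
    unfolding roots_def even_roots_def odd_roots_def by (force simp: image_iff)
  moreover have "finite ?S" by (intro finite_UnI finite_imageI finite_cartesian_product) auto
  ultimately show ?thesis by (rule finite_subset)
qed

lemma zero_root_space:
  fixes \<alpha> :: "complex ^ ('n::finite)"
  shows "0 \<in> root_space \<alpha>"
proof -
  have component: "component p 0 = (0 :: 'n smat)" for p
    by (simp add: component_def vec_eq_iff)
  have "(0 :: 'n smat) \<in> osp"
    by (simp add: osp_def component form_coordinates)
  moreover have "(mat c ** 0 :: 'n smat) = 0" "(A ** 0 :: 'n smat) = 0" "(0 ** A :: 'n smat) = 0"
    for c and A :: "'n smat"
    by (simp_all add: matrix_matrix_mult_def vec_eq_iff)
  ultimately show "(0 :: 'n smat) \<in> root_space \<alpha>"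
    by (simp add: root_space_def superbracket_def component)
qed

lemma root_space_subset_nilradical:
  fixes P :: "(complex ^ ('n::finite)) set"
  assumes P: "parabolic P" and \<alpha>: "\<alpha> \<in> nilradical_roots P"
  shows "root_space \<alpha> \<subseteq> nilradical P"
proof
  fix X :: "'n smat" assume X: "X \<in> root_space \<alpha>"
  let ?x = "\<lambda>\<beta>. if \<beta> = \<alpha> then X else 0"
  (* A sum over an infinite set would be 0, so finiteness is what makes X appear. *)
  have "finite (nilradical_roots P)"
    using P finite_subset[OF _ finite_roots, of "nilradical_roots P"]
    by (auto simp: parabolic_def nilradical_roots_def)
  then have "X = (\<Sum>\<beta>\<in>nilradical_roots P. ?x \<beta>)"
    using \<alpha> by simp
  moreover have "\<forall>\<beta>\<in>nilradical_roots P. ?x \<beta> \<in> root_space \<beta>"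
    using X by (simp add: zero_root_space)
  ultimately show "X \<in> nilradical P"
    unfolding nilradical_def by blast
qed

theorem theorem2p8:
  shows "\<nexists>P :: (complex ^ ('n::finite)) set. cominuscule P"
proof
  assume "\<exists>P :: (complex ^ 'n) set. cominuscule P"
  then obtain P :: "(complex ^ 'n) set" where P: "parabolic P"
    and abelian: "\<forall>X\<in>nilradical P. \<forall>Y\<in>nilradical P. superbracket X Y = 0"
    unfolding cominuscule_def by blast
  from parabolic_odd_root[OF P] obtain b and k :: 'n
    where "sgn_of b *s delta k \<in> nilradical_roots P" .
  then have "odd_root_vector b k \<in> nilradical P"
    using root_space_subset_nilradical[OF P] odd_root_vector_root_space by blast
  then show False
    using abelian superbracket_odd_root_vector by blast
qed

end
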